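(* Let $$\mathcal V=\{v\in\mathbb R^{nm} : (v-\bar v_i)^\top S_i^{-1}(v-\bar v_i)\le r_i^2\ \ (i=1,\dots,\ell),\ Qv\succeq e,\ v\succeq 0\}.$$ The robust utilitarian welfare problem $$\max_{a\in\mathcal A}\ \min_{v\in\mathcal V}\ w\cdot u(a,v)=\max_{a\in\mathcal A}\ \min_{v\in\mathcal V}\ a^\top v$$ is equivalent to solving $$\max_{\xi\in\Lambda,\ \lambda\in\mathbb R_{\ge0}^{\ell},\ \beta\in\mathbb R_{\ge0}^{k}}\ \ p^\top T q+\beta^\top e-\tfrac14\,p^\top T p+\sum_{i=1}^{\ell}\left(\lambda_i\,\bar v_i^\top S_i^{-1}\bar v_i-\lambda_i r_i^2\right)-q^\top T q ,$$ where $p=\xi-Q^\top\beta$, $q=\sum_{i=1}^{\ell}\lambda_iS_i^{-1}\bar v_i$ and $T=\bigl(\sum_{i=1}^{\ell}\lambda_iS_i^{-1}\bigr)^{-1}$. Let $\xi^*$ be the optimal $\xi$ in the latter problem. Then the optimal allocation $a^*$ can be derived from $\xi^*$ by finding $a\in\mathcal A$ such that $a_G\preceq\xi^*_G$ for every group $G\in\mathcal G$.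
   Context: There are $n$ agents $N$, partitioned into groups $\mathcal G=\{G_1,\dots,G_g\}$, and $m$ item types $I$. Allocations and valuations are $n\times m$ matrices, vectorized in row-major order as $a,v\in\mathbb R^{nm}$; $x_G\in\mathbb R^{|G|m}$ is the restriction of a vector $x$ to the agents in $G$; $x_{j,i}$ is the entry of $x$ for agent $j$ and item $i$. $\succeq,\preceq$ are coordinatewise. The set of feasible (continuous) allocations $\mathcal A$ consists of all $a\in\mathbb R_{\ge0}^{nm}$ with $\underline\kappa_j\le\sum_{i\in I}a_{j,i}\le\bar\kappa_j$ for each agent $j$, $\underline\psi_i\le\sum_{j\in N}a_{j,i}\le\bar\psi_i$ for each item $i$, and $a\preceq c$, for given bounds $\underline\kappa,\bar\kappa,\underline\psi,\bar\psi,c$. Group utilities are $u_G(a,v)=a_G^\top v_G/|G|$, and weighted utilitarian welfare is $w\cdot u=\sum_G w_Gu_G$; without loss of generality $w_G=|G|$, so welfare equals $a^\top v$. The data of $\mathcal V$ are centers $\bar v_i\in\mathbb R_{\ge 0}^{nm}$, positive semi-definite covariance matrices $S_i\in\mathbb R^{nm\times nm}$ (whose inverses are used), radii $r_i\in\mathbb R$, $Q\in\mathbb R^{k\times nm}$ and $e\in\mathbb R^k$; the inner minimization over $\mathcal V$ is taken to be strictly feasible (Slater's condition). The set $\Lambda$ is given as $$\Lambda\doteq\mathcal A-\mathbb R_{\ge0}^{nm}=\Bigl\{\xi\in\mathbb R^{nm}:\ \sum_{i\in I}\xi_{j,i}\le\bar\kappa_j\ \forall j\in N,\ \ \sum_{j\in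 N}\xi_{j,i}\le\bar\psi_i\ \forall i\in I,\ \ \xi\preceq c\Bigr\}.$$
   Formalization: The recovery condition is corrected to ξ*_G ⪯ a_G (as printed it is false); Λ is A − R_{≥0}^{nm}, which the listed upper-bound system does not equal in general; λ = 0, where T is undefined, is allowed only with p = 0; A is assumed nonempty. *)

theory Defs
  imports "HOL-Analysis.Analysis" "HOL-Library.Disjoint_Sets"
begin

(* Agents are the type 'n, item types the type 'm; R^(nm) is real ^ ('n \<times> 'm), with
   x $ (j, i) the entry of x for agent j and item i.  On vectors, \<le> is the coordinatewise
   order (its strict part < is not coordinatewise strictness). *)

definition allocations ::
  "real ^ 'n \<Rightarrow> real ^ 'n \<Rightarrow> real ^ 'm \<Rightarrow> real ^ 'm \<Rightarrow> real ^ ('n \<times> 'm)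
     \<Rightarrow> (real ^ ('n::finite \<times> 'm::finite)) set" where
  "allocations kl ku pl pu c =
     {a. 0 \<le> a \<and> a \<le> c
       \<and> (\<forall>j. kl $ j \<le> (\<Sum>i\<in>UNIV. a $ (j, i)) \<and> (\<Sum>i\<in>UNIV. a $ (j, i)) \<le> ku $ j)
       \<and> (\<forall>i. pl $ i \<le> (\<Sum>j\<in>UNIV. a $ (j, i)) \<and> (\<Sum>j\<in>UNIV. a $ (j, i)) \<le> pu $ i)}"

definition group_utility ::
  "'n set \<Rightarrow> real ^ ('n \<times> 'm) \<Rightarrow> real ^ ('n::finite \<times> 'm::finite) \<Rightarrow> real" where
  "group_utility G a v = (\<Sum>j\<in>G. \<Sum>i\<in>UNIV. a $ (j, i) * v $ (j, i)) / real (card G)"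

definition welfare ::
  "'n set set \<Rightarrow> ('n set \<Rightarrow> real) \<Rightarrow> real ^ ('n \<times> 'm) \<Rightarrow> real ^ ('n::finite \<times> 'm::finite) \<Rightarrow> real" where
  "welfare \<G> w a v = (\<Sum>G\<in>\<G>. w G * group_utility G a v)"

definition restr_le :: "'n set \<Rightarrow> real ^ ('n \<times> 'm) \<Rightarrow> real ^ ('n::finite \<times> 'm::finite) \<Rightarrow> bool" where
  "restr_le G x y \<longleftrightarrow> (\<forall>j\<in>G. \<forall>i. x $ (j, i) \<le> y $ (j, i))"

definition pos_semidef :: "real ^ 'd ^ 'd \<Rightarrow> bool" where
  "pos_semidef S \<longleftrightarrow> transpose S = S \<and> (\<forall>x. 0 \<le> x \<bullet> (S *v x))"

definition valuations ::
  "('l \<Rightarrow> real ^ 'd) \<Rightarrow> ('l \<Rightarrow> real ^ 'd ^ 'd) \<Rightarrow> ('l \<Rightarrow> real) \<Rightarrow> real ^ 'd ^ 'k \<Rightarrow> real ^ 'k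
     \<Rightarrow> (real ^ 'd::finite) set" where
  "valuations vbar S r Q e =
     {v. (\<forall>i. (v - vbar i) \<bullet> (matrix_inv (S i) *v (v - vbar i)) \<le> (r i)\<^sup>2) \<and> e \<le> Q *v v \<and> 0 \<le> v}"

definition strictly_feasible ::
  "('l \<Rightarrow> real ^ 'd) \<Rightarrow> ('l \<Rightarrow> real ^ 'd ^ 'd) \<Rightarrow> ('l \<Rightarrow> real) \<Rightarrow> real ^ 'd ^ 'k \<Rightarrow> real ^ 'k
     \<Rightarrow> real ^ 'd::finite \<Rightarrow> bool" where
  "strictly_feasible vbar S r Q e v \<longleftrightarrow>
     (\<forall>i. (v - vbar i) \<bullet> (matrix_inv (S i) *v (v - vbar i)) < (r i)\<^sup>2)
     \<and> (\<forall>t. e $ t < (Q *v v) $ t) \<and> (\<forall>s. 0 < v $ s)"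

definition robust_welfare ::
  "'n set set \<Rightarrow> ('n set \<Rightarrow> real) \<Rightarrow> (real ^ ('n::finite \<times> 'm::finite)) set
     \<Rightarrow> real ^ ('n \<times> 'm) \<Rightarrow> real" where
  "robust_welfare \<G> w V a = (INF v\<in>V. welfare \<G> w a v)"

(* \<Lambda> is the Minkowski difference of the set A of allocations and the nonnegative orthant.
   The system of upper bounds on row sums, column sums and entries alone describes a set that is
   larger in general: with one agent, two items, row bound 1 and large c, it contains
   (2, -1), which no allocation dominates.
   A point of \<Lambda> lies below an allocation, so an allocation is recovered from \<xi> by going up:
   one looks for a in A with \<xi> \<le> a on every group, not a \<le> \<xi>. *)
definition Lam :: "(real ^ 'd::finite) set \<Rightarrow> (real ^ 'd) set" where
  "Lam A = {a - y | a y. a \<in> A \<and> 0 \<le> y}"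

definition dual_p :: "real ^ 'd ^ 'k \<Rightarrow> real ^ 'd \<Rightarrow> real ^ 'k::finite \<Rightarrow> real ^ 'd::finite" where
  "dual_p Q \<xi> \<beta> = \<xi> - transpose Q *v \<beta>"

definition dual_q ::
  "('l::finite \<Rightarrow> real ^ 'd) \<Rightarrow> ('l \<Rightarrow> real ^ 'd ^ 'd) \<Rightarrow> real ^ 'l \<Rightarrow> real ^ 'd::finite" where
  "dual_q vbar S lam = (\<Sum>i\<in>UNIV. lam $ i *\<^sub>R (matrix_inv (S i) *v vbar i))"

definition dual_T :: "('l::finite \<Rightarrow> real ^ 'd ^ 'd) \<Rightarrow> real ^ 'l \<Rightarrow> real ^ 'd ^ 'd::finite" where
  "dual_T S lam = matrix_inv (\<Sum>i\<in>UNIV. lam $ i *\<^sub>R matrix_inv (S i))"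

definition dual_objective ::
  "('l::finite \<Rightarrow> real ^ 'd) \<Rightarrow> ('l \<Rightarrow> real ^ 'd ^ 'd) \<Rightarrow> ('l \<Rightarrow> real)
     \<Rightarrow> real ^ 'd ^ 'k::finite \<Rightarrow> real ^ 'k
     \<Rightarrow> (real ^ 'd::finite) \<times> (real ^ 'l) \<times> (real ^ 'k) \<Rightarrow> real" where
  "dual_objective vbar S r Q e = (\<lambda>(\<xi>, lam, \<beta>).
     let p = dual_p Q \<xi> \<beta>; q = dual_q vbar S lam; T = dual_T S lam in
       p \<bullet> (T *v q) + \<beta> \<bullet> e - 1 / 4 * (p \<bullet> (T *v p))
       + (\<Sum>i\<in>UNIV. lam $ i * (vbar i \<bullet> (matrix_inv (S i) *v vbar i)) - lam $ i * (r i)\<^sup>2)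
       - q \<bullet> (T *v q))"

(* The last conjunct is the implicit domain of the objective.  At lam = 0 the matrix inverted in T
   is 0 and q = 0; the objective is read there with the usual convention that the quadratic form
   of the inverse of 0 is 0 at p = 0 and infinite at p \<noteq> 0.  So points with lam = 0 and p \<noteq> 0 have
   value minus infinity and are excluded, while at lam = 0, p = 0 every term containing T vanishes,
   whatever matrix T is, and dual_objective is \<beta> \<bullet> e. *)
definition dual_feasible ::
  "(real ^ 'd::finite) set \<Rightarrow> real ^ 'd ^ 'k::finite
     \<Rightarrow> ((real ^ 'd) \<times> (real ^ 'l::finite) \<times> (real ^ 'k)) set" where
  "dual_feasible A Q =
     {(\<xi>, lam, \<beta>). \<xi> \<in> Lam A \<and> 0 \<le> lam \<and> 0 \<le> \<beta> \<and> (lam = 0 \<longrightarrow> dual_p Q \<xi> \<beta> = 0)}"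

end

(* The dual objective at (xi, lam, beta) is the minimum over all v of the Lagrangian in which the
   ellipsoid constraints carry the multipliers lam, the constraints Q v >= e the multipliers beta,
   and v >= 0 the multipliers y = a - xi.  The Lagrangian is a quadratic in v, and completing the
   square with the matrix M = sum_i lam_i S_i^-1 gives the closed formula.  Weak duality bounds the
   dual value at xi by the robust welfare of every allocation above xi; Slater's condition produces
   multipliers that attain the robust welfare of a given allocation. *)

theory Submission
  imports Defs
begin

section \<open>Positive semi-definite and positive definite matrices\<close>

lemma pos_semidef_symmetric:
  fixes S :: "real ^ 'd ^ 'd"
  assumes "pos_semidef S"
  shows "x \<bullet> (S *v y) = (S *v x) \<bullet> y"
  using assms by (metis dot_lmul_matrix pos_semidef_def vector_transpose_matrix)

lemma quadratic_form_add_scaled: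
  fixes S :: "real ^ 'd ^ 'd"
  assumes "pos_semidef S"
  shows "(x + t *\<^sub>R y) \<bullet> (S *v (x + t *\<^sub>R y)) =
    x \<bullet> (S *v x) + 2 * t * (y \<bullet> (S *v x)) + t\<^sup>2 * (y \<bullet> (S *v y))"
proof -
  have "x \<bullet> (S *v y) = y \<bullet> (S *v x)"
    using pos_semidef_symmetric[OF assms] by (metis inner_commute)
  then show ?thesis
    by (simp add: matrix_vector_right_distrib inner_add_left inner_add_right
        matrix_vector_mult_scaleR power2_eq_square algebra_simps)
qed

text \<open>A zero of a nonnegative quadratic form is a minimum, so the gradient
  \<open>2 *\<^sub>R (S *v x)\<close> vanishes there; otherwise a small step from \<open>x\<close>
  against \<open>S *v x\<close> would make the form negative.\<close>

lemma pos_semidef_kernel: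
  fixes S :: "real ^ 'd ^ 'd"
  assumes S: "pos_semidef S" and zero: "x \<bullet> (S *v x) = 0"
  shows "S *v x = 0"
proof (rule ccontr)
  define z where "z = S *v x"
  define b where "b = z \<bullet> z"
  define k where "k = z \<bullet> (S *v z)"
  assume "S *v x \<noteq> 0"
  then have b: "b > 0" by (simp add: b_def z_def)
  have k: "k \<ge> 0" using S by (simp add: k_def pos_semidef_def)
  \<comment> \<open>The step must be short enough that the quadratic gain \<open>t * t * k\<close>
    stays below the linear loss \<open>2 * t * b\<close>; the summand 1 keeps the denominator
    positive when \<open>k = 0\<close>.\<close>
  define t where "t = b / (k + 1)"
  have t: "t > 0" using b k by (simp add: t_def)
  have "0 \<le> (x + (- t) *\<^sub>R z) \<bullet> (S *v (x + (- t) *\<^sub>R z))"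
    using S by (simp only: pos_semidef_def)
  also have "\<dots> = t * (t * k - 2 * b)"
    unfolding quadratic_form_add_scaled[OF S] zero
    by (simp add: b_def k_def z_def power2_eq_square algebra_simps)
  finally have "t * k \<ge> 2 * b" using t by (simp add: zero_le_mult_iff)
  moreover have "t * k \<le> t * (k + 1)" using t by simp
  moreover have "t * (k + 1) = b" using k by (simp add: t_def)
  ultimately show False using b by linarith
qed

lemma matrix_inv_mult:
  fixes S :: "real ^ 'd ^ 'd"
  assumes "invertible S"
  shows "S ** matrix_inv S = mat 1" "matrix_inv S ** S = mat 1"
  using someI_ex[OF assms[unfolded invertible_def]] by (simp_all add: matrix_inv_def)

lemma matrix_inv_mult_vector:
  fixes S :: "real ^ 'd ^ 'd"
  assumes "invertible S"
  shows "S *v (matrix_inv S *v x) = x" "matrix_inv S *v (S *v x) = x"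
  using assms by (simp_all add: matrix_vector_mul_assoc matrix_inv_mult)

lemma pos_semidef_invertible_pos:
  fixes S :: "real ^ 'd ^ 'd"
  assumes "pos_semidef S" "invertible S" "x \<noteq> 0"
  shows "0 < x \<bullet> (S *v x)"
proof -
  have "S *v x \<noteq> 0"
    using assms(2,3) by (metis matrix_inv_mult_vector(2) matrix_vector_mult_0_right)
  with pos_semidef_kernel[OF assms(1)] assms(1) show ?thesis
    by (metis less_eq_real_def pos_semidef_def)
qed

text \<open>The transpose of the inverse is a left inverse of \<open>S\<close>, hence the inverse
  itself. The form of the inverse at \<open>x = S *v y\<close> is the form of \<open>S\<close> at
  \<open>y\<close>.\<close>

lemma pos_semidef_matrix_inv:
  fixes S :: "real ^ 'd ^ 'd"
  assumes S: "pos_semidef S" and inv: "invertible S"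
  shows "pos_semidef (matrix_inv S)"
  unfolding pos_semidef_def
proof (intro conjI allI)
  have "transpose (matrix_inv S) ** S = transpose (S ** matrix_inv S)"
    using S by (simp add: matrix_transpose_mul pos_semidef_def)
  then have "transpose (matrix_inv S) ** S = mat 1"
    by (simp add: matrix_inv_mult(1)[OF inv])
  then have "(transpose (matrix_inv S) ** S) ** matrix_inv S = matrix_inv S"
    by simp
  then show "transpose (matrix_inv S) = matrix_inv S"
    by (simp add: matrix_inv_mult(1)[OF inv] flip: matrix_mul_assoc)
  fix x
  have "x \<bullet> (matrix_inv S *v x) = (S *v (matrix_inv S *v x)) \<bullet> (matrix_inv S *v x)"
    by (simp add: matrix_inv_mult_vector[OF inv])
  also have "\<dots> \<ge> 0" using S by (metis inner_commute pos_semidef_def)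
  finally show "0 \<le> x \<bullet> (matrix_inv S *v x)" .
qed

lemma invertible_matrix_inv:
  fixes S :: "real ^ 'd ^ 'd"
  assumes "invertible S"
  shows "invertible (matrix_inv S)"
  using matrix_inv_mult[OF assms] by (auto simp: invertible_def)

lemma invertible_if_pos_definite:
  fixes M :: "real ^ 'd ^ 'd"
  assumes "\<And>x. x \<noteq> 0 \<Longrightarrow> 0 < x \<bullet> (M *v x)"
  shows "invertible M"
proof -
  have "x = 0" if "M *v x = 0" for x
    using assms[of x] that by (cases "x = 0") auto
  then show ?thesis
    by (metis invertible_left_inverse matrix_left_invertible_ker)
qed

text \<open>By homogeneity the constant is the minimum of the form on the compact unit sphere. It is
  what makes an ellipsoid bounded.\<close>

lemma pos_definite_coercive:
  fixes M :: "real ^ 'd ^ 'd"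
  assumes pos: "\<And>x. x \<noteq> 0 \<Longrightarrow> 0 < x \<bullet> (M *v x)"
  obtains k where "0 < k" "\<And>x. k * (norm x)\<^sup>2 \<le> x \<bullet> (M *v x)"
proof -
  have "continuous_on (sphere 0 1) (\<lambda>x. x \<bullet> (M *v x))"
    by (intro continuous_intros)
  moreover have "sphere 0 1 \<noteq> ({} :: (real ^ 'd) set)" by simp
  ultimately obtain u where u: "norm u = 1"
    and min: "\<And>x. norm x = 1 \<Longrightarrow> u \<bullet> (M *v u) \<le> x \<bullet> (M *v x)"
    using continuous_attains_inf[of "sphere 0 1" "\<lambda>x. x \<bullet> (M *v x)"] by auto
  have "(u \<bullet> (M *v u)) * (norm x)\<^sup>2 \<le> x \<bullet> (M *v x)" for x
  proof (cases "x = 0")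
    case False
    define y where "y = x /\<^sub>R norm x"
    have "norm y = 1" and x: "x = norm x *\<^sub>R y" using False by (simp_all add: y_def)
    have "x \<bullet> (M *v x) = (norm x)\<^sup>2 * (y \<bullet> (M *v y))"
      by (subst (1 2) x) (simp add: matrix_vector_mult_scaleR power2_eq_square)
    with mult_right_mono[OF min[OF \<open>norm y = 1\<close>], of "(norm x)\<^sup>2"] show ?thesis
      by (simp add: mult.commute)
  qed simp
  moreover have "u \<noteq> 0" using u by auto
  ultimately show ?thesis using pos that by blast
qed

section \<open>Convexity, a theorem of the alternative, and Slater multipliers\<close>

lemma convex_on_quadratic_form:
  fixes M :: "real ^ 'd ^ 'd"
  assumes M: "pos_semidef M"
  shows "convex_on UNIV (\<lambda>v. (v - b) \<bullet> (M *v (v - b)))"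
proof (rule convex_onI)
  fix t :: real and x y :: "real ^ 'd"
  assume t: "0 < t" "t < 1"
  define X Y where "X = x - b" and "Y = y - x"
  have 1: "(1 - t) *\<^sub>R x + t *\<^sub>R y - b = X + t *\<^sub>R Y" and 2: "y - b = X + 1 *\<^sub>R Y"
    by (simp_all add: X_def Y_def algebra_simps)
  \<comment> \<open>Along a segment the form is a quadratic in \<open>t\<close> with nonnegative
    leading coefficient; replacing \<open>t\<^sup>2\<close> by \<open>t\<close> there turns it into
    the chord.\<close>
  have "t\<^sup>2 \<le> t" using t by (simp add: power2_eq_square)
  then have "t\<^sup>2 * (Y \<bullet> (M *v Y)) \<le> t * (Y \<bullet> (M *v Y))"
    using M by (intro mult_right_mono) (auto simp: pos_semidef_def)
  then show "((1 - t) *\<^sub>R x + t *\<^sub>R y - b) \<bullet> (M *v ((1 - t) *\<^sub>R x + t *\<^sub>R y - b))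
      \<le> (1 - t) * ((x - b) \<bullet> (M *v (x - b))) + t * ((y - b) \<bullet> (M *v (y - b)))"
    unfolding 1 2 quadratic_form_add_scaled[OF M] X_def[symmetric]
    by (simp add: algebra_simps)
qed simp

text \<open>A Gordan-type alternative for convex functions. The multipliers are the normal of a
  hyperplane separating 0 from the vectors that strictly exceed some value vector of the
  \<open>f j\<close>.\<close>

lemma convex_alternative:
  fixes f :: "'j::finite \<Rightarrow> 'a::real_vector \<Rightarrow> real"
  assumes conv: "\<And>j. convex_on UNIV (f j)" and none: "\<nexists>v. \<forall>j. f j v < 0"
  obtains \<mu> :: "'j \<Rightarrow> real" where "\<exists>j. \<mu> j \<noteq> 0" "\<And>j. 0 \<le> \<mu> j" "\<And>v. 0 \<le> (\<Sum>j\<in>UNIV. \<mu> j * f j v)"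
proof -
  \<comment> \<open>Taking everything above the value vectors makes the set convex, which the set of
    values alone need not be, and forces the normal to have nonnegative entries.\<close>
  define C :: "(real ^ 'j) set" where "C = {u. \<exists>v. \<forall>j. f j v < u $ j}"
  have "convex C"
    unfolding convex_alt
  proof safe
    fix x y :: "real ^ 'j" and t :: real
    assume "x \<in> C" "y \<in> C" and t: "0 \<le> t" "t \<le> 1"
    then obtain v v' where v: "\<And>j. f j v < x $ j" "\<And>j. f j v' < y $ j"
      by (auto simp: C_def)
    have "f j ((1 - t) *\<^sub>R v + t *\<^sub>R v') < ((1 - t) *\<^sub>R x + t *\<^sub>R y) $ j" for j
    proof -
      have "f j ((1 - t) *\<^sub>R v + t *\<^sub>R v') \<le> (1 - t) * f j v + t * f j v'"
        using convex_onD[OF conv t] by simp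
      also have "\<dots> < (1 - t) * x $ j + t * y $ j"
      proof (cases "t = 0")
        case False
        then show ?thesis using t v[of j]
          by (intro add_le_less_mono mult_left_mono mult_strict_left_mono) auto
      qed (use v in simp)
      finally show ?thesis by simp
    qed
    then show "(1 - t) *\<^sub>R x + t *\<^sub>R y \<in> C" unfolding C_def by blast
  qed
  moreover have "0 \<notin> C" using none by (simp add: C_def)
  ultimately obtain m where m: "m \<noteq> 0" "\<And>u. u \<in> C \<Longrightarrow> 0 \<le> m \<bullet> u"
    using separating_hyperplane_set_0[of C] by blast
  have shift: "0 \<le> (\<Sum>j\<in>UNIV. m $ j * f j v) + (\<Sum>j\<in>UNIV. m $ j * s j)" if "\<And>j. s j > 0" for v s
  proof -
    have "(\<chi> j. f j v + s j) \<in> C" unfolding C_def using that by (intro CollectI exI[of _ v]) simp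
    from m(2)[OF this] show ?thesis
      by (simp add: inner_vec_def algebra_simps sum.distrib)
  qed
  have "0 \<le> m $ i" for i
  proof (rule ccontr)
    assume "\<not> 0 \<le> m $ i"
    then have neg: "m $ i < 0" by simp
    \<comment> \<open>With slack \<open>s\<close>, coordinate \<open>i\<close> contributes
      \<open>m $ i - B\<close>, and \<open>B\<close> is large enough to push the whole sum of
      \<open>shift\<close> at \<open>v = 0\<close> to at most -1.\<close>
    define B where "B = \<bar>\<Sum>j\<in>UNIV. m $ j * f j 0\<bar> + \<bar>\<Sum>j\<in>UNIV. m $ j\<bar> + 1"
    define s where "s j = 1 + (if j = i then B / - m $ i else 0)" for j
    have "B > 0" by (simp add: B_def add_nonneg_pos)
    then have "s j > 0" for j using neg by (simp add: s_def add_pos_pos)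
    from shift[of s 0, OF this]
    have "0 \<le> (\<Sum>j\<in>UNIV. m $ j * f j 0) + (\<Sum>j\<in>UNIV. m $ j * s j)" .
    moreover have "m $ j * s j = m $ j + (if j = i then - B else 0)" for j
      using neg by (simp add: s_def field_simps)
    then have "(\<Sum>j\<in>UNIV. m $ j * s j) = (\<Sum>j\<in>UNIV. m $ j) - B"
      by (simp add: sum.distrib)
    ultimately show False by (simp add: B_def)
  qed
  moreover have "0 \<le> (\<Sum>j\<in>UNIV. m $ j * f j v)" for v
  \<comment> \<open>The value vector of \<open>v\<close> is only a limit of points of
    \<open>C\<close>. A uniform slack \<open>\<epsilon> / \<sigma>\<close> reaches \<open>C\<close>
    and adds at most \<open>\<epsilon>\<close> to the sum.\<close>
  proof (rule field_le_epsilon)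
    fix \<epsilon> :: real assume "0 < \<epsilon>"
    define \<sigma> where "\<sigma> = \<bar>\<Sum>j\<in>UNIV. m $ j\<bar> + 1"
    have \<sigma>: "\<sigma> > 0" by (simp add: \<sigma>_def add_nonneg_pos)
    have "0 \<le> (\<Sum>j\<in>UNIV. m $ j * f j v) + (\<Sum>j\<in>UNIV. m $ j * (\<epsilon> / \<sigma>))"
      using shift[of "\<lambda>_. \<epsilon> / \<sigma>"] \<sigma> \<open>0 < \<epsilon>\<close> by simp
    moreover have "(\<Sum>j\<in>UNIV. m $ j * (\<epsilon> / \<sigma>)) \<le> \<sigma> * (\<epsilon> / \<sigma>)"
      unfolding sum_distrib_right[symmetric] using \<sigma> \<open>0 < \<epsilon>\<close>
      by (intro mult_right_mono) (auto simp: \<sigma>_def)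
    ultimately show "0 \<le> (\<Sum>j\<in>UNIV. m $ j * f j v) + \<epsilon>" using \<sigma> by simp
  qed
  moreover have "\<exists>j. m $ j \<noteq> 0" using m(1) by (simp add: vec_eq_iff)
  ultimately show ?thesis using that by blast
qed

text \<open>The alternative is applied to the constraints together with \<open>f - b\<close>,
  indexed by \<open>None\<close>: the bound \<open>b\<close> says that these cannot all be negative
  at once. Slater's condition makes the multiplier of \<open>None\<close> positive, so dividing by
  it normalizes the inequality.\<close>

lemma slater_multipliers:
  fixes f :: "'a::real_vector \<Rightarrow> real" and g :: "'j::finite \<Rightarrow> 'a \<Rightarrow> real"
  assumes f: "convex_on UNIV f" and g: "\<And>j. convex_on UNIV (g j)"
    and slater: "\<And>j. g j v0 < 0"
    and lower: "\<And>v. (\<And>j. g j v \<le> 0) \<Longrightarrow> b \<le> f v"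
  obtains \<mu> :: "'j \<Rightarrow> real" where "\<And>j. 0 \<le> \<mu> j" "\<And>v. b \<le> f v + (\<Sum>j\<in>UNIV. \<mu> j * g j v)"
proof -
  define F where "F i = (case i of None \<Rightarrow> (\<lambda>v. f v + - b) | Some j \<Rightarrow> g j)" for i
  have conv: "convex_on UNIV (F i)" for i
    using convex_on_add[OF f, of "\<lambda>_. - b"] g
    by (cases i) (simp_all add: F_def convex_on_const)
  have none: "\<nexists>v. \<forall>i. F i v < 0"
  proof
    assume "\<exists>v. \<forall>i. F i v < 0"
    then obtain v where v: "\<And>i. F i v < 0" by blast
    have "b \<le> f v" using v[of "Some _"] by (intro lower) (simp add: F_def less_imp_le)
    with v[of None] show False by (simp add: F_def)
  qed
  obtain \<mu> where nz: "\<exists>i. \<mu> i \<noteq> 0" and \<mu>: "\<And>i. 0 \<le> \<mu> i"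
    and "\<And>v. 0 \<le> (\<Sum>i\<in>UNIV. \<mu> i * F i v)"
    using convex_alternative[OF conv none] by blast
  then have le: "0 \<le> \<mu> None * (f v - b) + (\<Sum>j\<in>UNIV. \<mu> (Some j) * g j v)" for v
    by (simp add: F_def UNIV_option_conv sum.reindex)
  have "\<mu> None \<noteq> 0"
  proof
    \<comment> \<open>Some constraint would then carry a positive multiplier, and at the Slater
      point the weighted sum of the constraints would be negative.\<close>
    assume 0: "\<mu> None = 0"
    with nz obtain j where "\<mu> (Some j) \<noteq> 0" by (metis not_Some_eq)
    then have "0 < \<mu> (Some j) * - g j v0"
      using \<mu>[of "Some j"] slater[of j] by (intro mult_pos_pos) auto
    then have "0 < (\<Sum>j\<in>UNIV. \<mu> (Some j) * - g j v0)"
      using \<mu> slater by (intro sum_pos2[of _ j] mult_nonneg_nonneg) (auto simp: less_imp_le)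
    with le[of v0] 0 show False by (simp add: sum_negf)
  qed
  with \<mu> have pos: "\<mu> None > 0" by (simp add: less_le)
  show ?thesis
  proof
    show "0 \<le> \<mu> (Some j) / \<mu> None" for j using \<mu> by simp
    show "b \<le> f v + (\<Sum>j\<in>UNIV. \<mu> (Some j) / \<mu> None * g j v)" for v
    proof -
      have "0 \<le> (\<mu> None * (f v - b) + (\<Sum>j\<in>UNIV. \<mu> (Some j) * g j v)) / \<mu> None"
        using le pos by simp
      also have "\<dots> = f v - b + (\<Sum>j\<in>UNIV. \<mu> (Some j) / \<mu> None * g j v)"
        using pos by (simp add: add_divide_distrib sum_divide_distrib)
      finally show ?thesis by simp
    qed
  qed
qed

lemma convex_on_linear_add_const:
  fixes f :: "'a::real_vector \<Rightarrow> real"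
  assumes "linear f"
  shows "convex_on UNIV (\<lambda>x. f x + b)"
proof -
  have "f (s *\<^sub>R x + t *\<^sub>R y) + b = s * (f x + b) + t * (f y + b)" if "s + t = 1" for s t x y
  proof -
    have "b = s * b + t * b" using that by (simp flip: distrib_right)
    then show ?thesis by (simp add: linear_add[OF assms] linear_scale[OF assms] distrib_left)
  qed
  then show ?thesis by (simp add: convex_on_def)
qed

section \<open>The Lagrangian of the inner minimization, weak and strong duality\<close>

lemma sum_UNIV_Plus:
  fixes f :: "'a::finite + 'b::finite \<Rightarrow> 'c::comm_monoid_add"
  shows "(\<Sum>x\<in>UNIV. f x) = (\<Sum>x\<in>UNIV. f (Inl x)) + (\<Sum>x\<in>UNIV. f (Inr x))"
  by (simp add: sum.Plus flip: UNIV_Plus_UNIV)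

lemma inner_vec_mono:
  fixes x y v :: "real ^ 'd"
  assumes "x \<le> y" "0 \<le> v"
  shows "x \<bullet> v \<le> y \<bullet> v"
  using assms by (auto simp: inner_vec_def less_eq_vec_def intro!: sum_mono mult_right_mono)

text \<open>The term for \<open>v \<ge> 0\<close> is absorbed in \<open>\<xi> \<bullet> v\<close>:
  with multipliers \<open>y\<close> and \<open>\<xi> = a - y\<close> this is
  \<open>a \<bullet> v - y \<bullet> v\<close>.\<close>

definition lagrangian ::
  "('l::finite \<Rightarrow> real ^ 'd) \<Rightarrow> ('l \<Rightarrow> real ^ 'd ^ 'd) \<Rightarrow> ('l \<Rightarrow> real)
     \<Rightarrow> real ^ 'd ^ 'k::finite \<Rightarrow> real ^ 'k \<Rightarrow> real ^ 'd \<Rightarrow> real ^ 'l \<Rightarrow> real ^ 'k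
     \<Rightarrow> real ^ 'd::finite \<Rightarrow> real" where
  "lagrangian vbar S r Q e \<xi> lam \<beta> v =
     \<xi> \<bullet> v
     + (\<Sum>i\<in>UNIV. lam $ i * ((v - vbar i) \<bullet> (matrix_inv (S i) *v (v - vbar i)) - (r i)\<^sup>2))
     + \<beta> \<bullet> (e - Q *v v)"

text \<open>Semi-definite and invertible together mean positive definite, so each
  \<open>matrix_inv (S i)\<close> is a true inverse and each quadratic constraint describes a
  bounded set.\<close>

locale ellipsoidal =
  fixes vbar :: "'l::finite \<Rightarrow> real ^ 'd::finite"
    and S :: "'l \<Rightarrow> real ^ 'd ^ 'd"
    and r :: "'l \<Rightarrow> real"
    and Q :: "real ^ 'd ^ 'k::finite"
    and e :: "real ^ 'k"
  assumes psd: "pos_semidef (S i)"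
    and invertible: "invertible (S i)"
begin

abbreviation "P i \<equiv> matrix_inv (S i)"

abbreviation "M lam \<equiv> (\<Sum>i\<in>UNIV. lam $ i *\<^sub>R P i)"

lemma P_psd: "pos_semidef (P i)"
  using pos_semidef_matrix_inv psd invertible by blast

lemma P_pos: "x \<noteq> 0 \<Longrightarrow> 0 < x \<bullet> (P i *v x)"
  by (intro pos_semidef_invertible_pos P_psd invertible_matrix_inv invertible)

lemma M_mult_vector: "M lam *v x = (\<Sum>i\<in>UNIV. lam $ i *\<^sub>R (P i *v x))"
proof -
  have "linear (\<lambda>A. A *v x)"
    by (intro linearI) (simp_all add: matrix_vector_mult_add_rdistrib scaleR_matrix_vector_assoc)
  from linear_sum[OF this] show ?thesis by (simp add: scaleR_matrix_vector_assoc)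
qed

lemma M_quadratic_form: "x \<bullet> (M lam *v y) = (\<Sum>i\<in>UNIV. lam $ i * (x \<bullet> (P i *v y)))"
  by (simp add: M_mult_vector inner_sum_right)

lemma M_symmetric: "x \<bullet> (M lam *v y) = (M lam *v x) \<bullet> y"
  using pos_semidef_symmetric[OF P_psd] by (simp add: M_mult_vector inner_sum_right inner_sum_left)

text \<open>One positive weight is enough, because every \<open>P i\<close> is positive definite.
  Hence the matrix inverted in \<open>dual_T\<close> is invertible whenever \<open>lam\<close> is
  nonnegative and nonzero.\<close>

lemma M_pos:
  assumes "0 \<le> lam" "lam \<noteq> 0" "x \<noteq> 0"
  shows "0 < x \<bullet> (M lam *v x)"
proof -
  obtain i where "lam $ i \<noteq> 0" using assms(2) by (auto simp: vec_eq_iff)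
  then have "0 < lam $ i" using assms(1) by (simp add: less_eq_vec_def less_le)
  then have "0 < lam $ i * (x \<bullet> (P i *v x))" using P_pos[OF assms(3)] by simp
  moreover have "0 \<le> lam $ j * (x \<bullet> (P j *v x))" for j
    using assms(1) P_pos[OF assms(3), of j] by (simp add: less_eq_vec_def)
  ultimately show ?thesis
    unfolding M_quadratic_form by (intro sum_pos2[of _ i]) auto
qed

text \<open>The cross terms of the squares add up to \<open>-2\<close> times \<open>dual_q\<close>,
  and moving \<open>Q\<close> to the other side of the inner product turns \<open>\<xi>\<close> into
  \<open>dual_p\<close>.\<close>

lemma lagrangian_expand:
  "lagrangian vbar S r Q e \<xi> lam \<beta> v =
     dual_p Q \<xi> \<beta> \<bullet> v + v \<bullet> (M lam *v v) - 2 * (dual_q vbar S lam \<bullet> v)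
     + (\<Sum>i\<in>UNIV. lam $ i * (vbar i \<bullet> (P i *v vbar i)) - lam $ i * (r i)\<^sup>2) + \<beta> \<bullet> e"
proof -
  have sq: "(v - vbar i) \<bullet> (P i *v (v - vbar i)) =
      v \<bullet> (P i *v v) - 2 * ((P i *v vbar i) \<bullet> v) + vbar i \<bullet> (P i *v vbar i)" for i
    using quadratic_form_add_scaled[OF P_psd, of v "-1" "vbar i"]
      pos_semidef_symmetric[OF P_psd, of "vbar i" i v]
    by simp
  have "\<beta> \<bullet> (Q *v v) = (transpose Q *v \<beta>) \<bullet> v"
    by (simp add: dot_lmul_matrix)
  then show ?thesis
    unfolding lagrangian_def sq M_quadratic_form dual_p_def dual_q_def
    by (simp add: inner_diff_left inner_diff_right inner_sum_left algebra_simps sum.distrib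
        sum_subtractf sum_distrib_left)
qed

text \<open>The point \<open>u\<close> is where the gradient \<open>p + 2 M v - 2 q\<close>
  vanishes. The constant left over is \<open>-(q - p/2) \<bullet> T (q - p/2)\<close>, whose
  expansion gives exactly the terms of the dual objective that contain \<open>T\<close>.\<close>

lemma lagrangian_completed_square:
  fixes \<xi> v :: "real ^ 'd" and lam :: "real ^ 'l" and \<beta> :: "real ^ 'k"
  assumes lam: "0 \<le> lam" "lam \<noteq> 0"
  defines "u \<equiv> dual_T S lam *v (dual_q vbar S lam - (1 / 2) *\<^sub>R dual_p Q \<xi> \<beta>)"
  shows "lagrangian vbar S r Q e \<xi> lam \<beta> v =
    dual_objective vbar S r Q e (\<xi>, lam, \<beta>) + (v - u) \<bullet> (M lam *v (v - u))"
proof -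
  define p q T where "p = dual_p Q \<xi> \<beta>" and "q = dual_q vbar S lam" and "T = dual_T S lam"
  have inv: "invertible (M lam)"
    using invertible_if_pos_definite M_pos[OF lam] by blast
  have T: "M lam *v (T *v x) = x" for x
    unfolding T_def dual_T_def by (rule matrix_inv_mult_vector(1)[OF inv])
  \<comment> \<open>Symmetry of \<open>T\<close> is symmetry of \<open>M lam\<close> read at the
    vectors \<open>T *v x\<close> and \<open>T *v y\<close>.\<close>
  have T_sym: "x \<bullet> (T *v y) = y \<bullet> (T *v x)" for x y
    using M_symmetric[of "T *v x" lam "T *v y"] unfolding T by (simp add: inner_commute)
  have u: "u = T *v (q - (1 / 2) *\<^sub>R p)" by (simp add: u_def p_def q_def T_def)
  have Mu: "M lam *v u = q - (1 / 2) *\<^sub>R p" unfolding u T ..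
  have "u \<bullet> (M lam *v v) = (q - (1 / 2) *\<^sub>R p) \<bullet> v" unfolding M_symmetric Mu ..
  moreover have "v \<bullet> (M lam *v u) = (q - (1 / 2) *\<^sub>R p) \<bullet> v" unfolding Mu by (rule inner_commute)
  ultimately have "(v - u) \<bullet> (M lam *v (v - u)) =
      v \<bullet> (M lam *v v) - 2 * ((q - (1 / 2) *\<^sub>R p) \<bullet> v) + (q - (1 / 2) *\<^sub>R p) \<bullet> u"
    by (simp add: matrix_vector_mult_diff_distrib inner_diff_left inner_diff_right Mu inner_commute
        diff_divide_distrib)
  also have "(q - (1 / 2) *\<^sub>R p) \<bullet> u = q \<bullet> (T *v q) - p \<bullet> (T *v q) + 1 / 4 * (p \<bullet> (T *v p))"
    unfolding u using T_sym[of q p]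
    by (simp add: matrix_vector_mult_diff_distrib matrix_vector_mult_scaleR inner_diff_left
        inner_diff_right algebra_simps)
  finally show ?thesis
    unfolding lagrangian_expand dual_objective_def p_def[symmetric] q_def[symmetric] T_def[symmetric]
    by (simp add: Let_def inner_diff_left flip: p_def q_def T_def)
qed

lemma dual_objective_zero:
  assumes "dual_p Q \<xi> \<beta> = 0"
  shows "dual_objective vbar S r Q e (\<xi>, 0, \<beta>) = \<beta> \<bullet> e"
  using assms by (simp add: dual_objective_def dual_q_def Let_def)

lemma lagrangian_zero: "lagrangian vbar S r Q e \<xi> 0 \<beta> v = dual_p Q \<xi> \<beta> \<bullet> v + \<beta> \<bullet> e"
  by (simp add: lagrangian_expand dual_q_def)

text \<open>For nonzero \<open>lam\<close> the completed square is nonnegative; at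
  \<open>lam = 0\<close> the condition on \<open>dual_p\<close> makes the Lagrangian the constant
  \<open>\<beta> \<bullet> e\<close>.\<close>

lemma dual_objective_le_lagrangian:
  assumes "0 \<le> lam" "lam = 0 \<longrightarrow> dual_p Q \<xi> \<beta> = 0"
  shows "dual_objective vbar S r Q e (\<xi>, lam, \<beta>) \<le> lagrangian vbar S r Q e \<xi> lam \<beta> v"
proof (cases "lam = 0")
  case True
  with assms show ?thesis by (simp add: dual_objective_zero lagrangian_zero)
next
  case False
  have "0 \<le> x \<bullet> (M lam *v x)" for x
    using M_pos[OF assms(1) False, of x] by (cases "x = 0") auto
  then show ?thesis by (simp add: lagrangian_completed_square[OF assms(1) False])
qed

text \<open>At a feasible \<open>v\<close> every multiplier term of the Lagrangian is at most 0, and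
  \<open>v \<ge> 0\<close> gives \<open>\<xi> \<bullet> v \<le> a \<bullet> v\<close>.\<close>

lemma weak_duality:
  assumes "\<xi> \<le> a" "0 \<le> lam" "0 \<le> \<beta>" "lam = 0 \<longrightarrow> dual_p Q \<xi> \<beta> = 0"
    and v: "v \<in> valuations vbar S r Q e"
  shows "dual_objective vbar S r Q e (\<xi>, lam, \<beta>) \<le> a \<bullet> v"
proof -
  have "\<xi> \<bullet> v \<le> a \<bullet> v" using assms by (intro inner_vec_mono) (simp_all add: valuations_def)
  moreover have "(\<Sum>i\<in>UNIV. lam $ i * ((v - vbar i) \<bullet> (P i *v (v - vbar i)) - (r i)\<^sup>2)) \<le> 0"
    using v assms(2)
    by (intro sum_nonpos mult_nonneg_nonpos) (auto simp: valuations_def less_eq_vec_def)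
  moreover have "\<beta> \<bullet> (e - Q *v v) \<le> 0"
    using inner_vec_mono[of "e" "Q *v v" \<beta>] v assms(3)
    by (simp add: valuations_def inner_diff_right inner_commute)
  ultimately have "lagrangian vbar S r Q e \<xi> lam \<beta> v \<le> a \<bullet> v"
    unfolding lagrangian_def by linarith
  with dual_objective_le_lagrangian[OF assms(2,4)] show ?thesis by (rule order_trans)
qed

text \<open>Slater multipliers for all three families of constraints bound the Lagrangian below by
  \<open>b\<close> at every \<open>v\<close>. Subtracting the multipliers of
  \<open>v \<ge> 0\<close> from \<open>a\<close> gives \<open>\<xi>\<close>.\<close>

lemma strong_duality:
  assumes slater: "strictly_feasible vbar S r Q e v0"
    and lower: "\<And>v. v \<in> valuations vbar S r Q e \<Longrightarrow> b \<le> a \<bullet> v"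
  obtains \<xi> lam \<beta> where "\<xi> \<le> a" "0 \<le> lam" "0 \<le> \<beta>" "lam = 0 \<longrightarrow> dual_p Q \<xi> \<beta> = 0"
    "b \<le> dual_objective vbar S r Q e (\<xi>, lam, \<beta>)"
proof -
  \<comment> \<open>The summands \<open>+ - (r i)\<^sup>2\<close> and \<open>+ 0\<close> give each
    constraint the form of a convex or linear function plus a constant, as the convexity lemmas
    expect.\<close>
  define g :: "'l + 'k + 'd \<Rightarrow> real ^ 'd \<Rightarrow> real" where
    "g = case_sum (\<lambda>i v. (v - vbar i) \<bullet> (P i *v (v - vbar i)) + - (r i)\<^sup>2)
           (case_sum (\<lambda>t v. - ((Q *v v) $ t) + e $ t) (\<lambda>s v. - (v $ s) + 0))"
  have conv: "convex_on UNIV (g j)" for j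
  proof -
    have "convex_on UNIV (\<lambda>v. (v - vbar i) \<bullet> (P i *v (v - vbar i)) + - (r i)\<^sup>2)" for i
      by (intro convex_on_add convex_on_quadratic_form P_psd) (simp add: convex_on_const)
    moreover have "convex_on UNIV (\<lambda>v. - ((Q *v v) $ t) + e $ t)" for t
      by (intro convex_on_linear_add_const linearI)
        (simp_all add: matrix_vector_right_distrib matrix_vector_mult_scaleR)
    moreover have "convex_on UNIV (\<lambda>v :: real ^ 'd. - (v $ s) + 0)" for s
      by (intro convex_on_linear_add_const linearI) simp_all
    ultimately show ?thesis
      unfolding g_def by (auto split: sum.split)
  qed
  have obj: "convex_on UNIV (\<lambda>v. a \<bullet> v)"
    using convex_on_linear_add_const[of "\<lambda>v. a \<bullet> v" 0]
    by (simp add: bounded_linear.linear bounded_linear_inner_right)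
  have strict: "g j v0 < 0" for j
    using slater by (auto simp: g_def strictly_feasible_def split: sum.split)
  have feas: "b \<le> a \<bullet> v" if neg: "\<And>j. g j v \<le> 0" for v
  proof (rule lower)
    show "v \<in> valuations vbar S r Q e"
      using neg[of "Inl _"] neg[of "Inr (Inl _)"] neg[of "Inr (Inr _)"]
      by (simp add: g_def valuations_def less_eq_vec_def)
  qed
  obtain \<mu> where \<mu>: "\<And>j. 0 \<le> \<mu> j" and le: "\<And>v. b \<le> a \<bullet> v + (\<Sum>j\<in>UNIV. \<mu> j * g j v)"
    using slater_multipliers[where g = g and b = b, OF obj conv strict feas] by blast
  define lam \<beta> y where "lam = (\<chi> i. \<mu> (Inl i))" and "\<beta> = (\<chi> t. \<mu> (Inr (Inl t)))"
    and "y = (\<chi> s. \<mu> (Inr (Inr s)))"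
  have L: "b \<le> lagrangian vbar S r Q e (a - y) lam \<beta> v" for v
    using le[of v]
    by (simp add: sum_UNIV_Plus g_def lagrangian_def lam_def \<beta>_def y_def inner_vec_def
        algebra_simps sum.distrib sum_subtractf sum_negf)
  have lam: "0 \<le> lam" using \<mu> by (simp add: lam_def less_eq_vec_def)
  \<comment> \<open>At \<open>lam = 0\<close> the Lagrangian is affine in \<open>v\<close>, and it is bounded below only if its slope vanishes.\<close>
  have dom: "dual_p Q (a - y) \<beta> = 0" if "lam = 0"
  proof (rule ccontr)
    define p where "p = dual_p Q (a - y) \<beta>"
    assume "dual_p Q (a - y) \<beta> \<noteq> 0"
    then have pp: "p \<bullet> p > 0" by (simp add: p_def)
    \<comment> \<open>Moving by \<open>- s *\<^sub>R p\<close> lowers the affine Lagrangian from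
      \<open>\<beta> \<bullet> e\<close> to exactly \<open>b - 1\<close>.\<close>
    define s where "s = (\<beta> \<bullet> e - b + 1) / (p \<bullet> p)"
    have "b \<le> p \<bullet> (- s *\<^sub>R p) + \<beta> \<bullet> e"
      using L[of "- s *\<^sub>R p"] unfolding that lagrangian_zero p_def .
    also have "\<dots> = b - 1" using pp by (simp add: s_def)
    finally show False by simp
  qed
  have "b \<le> dual_objective vbar S r Q e (a - y, lam, \<beta>)"
  proof (cases "lam = 0")
    case True
    with dom L[of 0] show ?thesis by (simp add: dual_objective_zero lagrangian_zero)
  next
    case False
    \<comment> \<open>The bound is evaluated at the minimizer of the Lagrangian, where the square
      vanishes and the dual objective remains.\<close>
    show ?thesis
      using L[of "dual_T S lam *v (dual_q vbar S lam - (1 / 2) *\<^sub>R dual_p Q (a - y) \<beta>)"]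
      by (simp add: lagrangian_completed_square[OF lam False])
  qed
  moreover have "a - y \<le> a" "0 \<le> \<beta>" using \<mu> by (simp_all add: y_def \<beta>_def less_eq_vec_def)
  ultimately show ?thesis using that lam dom by blast
qed

lemma compact_valuations: "compact (valuations vbar S r Q e)"
proof -
  \<comment> \<open>Types are nonempty, so there is at least one ellipsoid, and it alone bounds the
    set.\<close>
  fix i :: 'l
  obtain k where k: "0 < k" "\<And>x. k * (norm x)\<^sup>2 \<le> x \<bullet> (P i *v x)"
    using pos_definite_coercive P_pos by blast
  have "norm v \<le> norm (vbar i) + sqrt ((r i)\<^sup>2 / k)" if "v \<in> valuations vbar S r Q e" for v
  proof -
    have "k * (norm (v - vbar i))\<^sup>2 \<le> (r i)\<^sup>2"
      using that unfolding valuations_def by (blast intro: order_trans[OF k(2)])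
    then have "norm (v - vbar i) \<le> sqrt ((r i)\<^sup>2 / k)"
      using k(1) by (intro real_le_rsqrt) (simp add: field_simps)
    then show ?thesis using norm_triangle_sub[of v "vbar i"] by linarith
  qed
  then have "bounded (valuations vbar S r Q e)" by (auto simp: bounded_iff)
  moreover have "closed (valuations vbar S r Q e)"
    unfolding valuations_def less_eq_vec_def
    by (intro closed_Collect_conj closed_Collect_all closed_Collect_le continuous_intros
        bounded_linear.continuous_on[OF matrix_vector_mul_bounded_linear])
  ultimately show ?thesis by (simp add: compact_eq_bounded_closed)
qed

end

section \<open>Compactness of the allocations, continuity of the robust welfare, and the
  groups\<close>

lemma compact_allocations: "compact (allocations kl ku pl pu c)"
proof -
  have "bounded (allocations kl ku pl pu c)"
    by (rule bounded_subset[OF bounded_cbox[of 0 c]])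
      (auto simp: allocations_def mem_box_cart less_eq_vec_def)
  moreover have "closed (allocations kl ku pl pu c)"
    unfolding allocations_def less_eq_vec_def
    by (intro closed_Collect_conj closed_Collect_all closed_Collect_le continuous_intros)
  ultimately show ?thesis by (simp add: compact_eq_bounded_closed)
qed

text \<open>A norm bound \<open>B\<close> on \<open>V\<close> makes every functional
  \<open>\<lambda>a. a \<bullet> v\<close> \<open>B\<close>-Lipschitz, and the infimum inherits the
  constant.\<close>

lemma continuous_on_INF_inner:
  fixes V :: "'a::real_inner set"
  assumes V: "compact V" "V \<noteq> {}"
  shows "continuous_on X (\<lambda>a. INF v\<in>V. a \<bullet> v)"
proof -
  define f where "f a = (INF v\<in>V. a \<bullet> v)" for a
  obtain B where B: "\<And>v. v \<in> V \<Longrightarrow> norm v \<le> B"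
    using compact_imp_bounded[OF V(1)] by (auto simp: bounded_iff)
  have bdd: "bdd_below ((\<lambda>v. a \<bullet> v) ` V)" for a
    by (intro bounded_imp_bdd_below compact_imp_bounded compact_continuous_image
        continuous_intros V(1))
  have le: "f a \<le> f b + B * norm (a - b)" for a b
  proof -
    have "f a - B * norm (a - b) \<le> b \<bullet> v" if "v \<in> V" for v
    proof -
      have "f a \<le> a \<bullet> v" unfolding f_def by (rule cINF_lower[OF bdd that])
      moreover have "(a - b) \<bullet> v \<le> norm (a - b) * norm v" by (rule norm_cauchy_schwarz)
      moreover have "norm (a - b) * norm v \<le> norm (a - b) * B"
        using B[OF that] by (intro mult_left_mono) auto
      ultimately show ?thesis by (simp add: inner_diff_left mult.commute)
    qed
    then have "f a - B * norm (a - b) \<le> f b"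
      unfolding f_def[of b] using V(2) by (intro cINF_greatest)
    then show ?thesis by simp
  qed
  have "B \<ge> 0" using V(2) B norm_ge_zero order_trans by blast
  have "B-lipschitz_on X f"
  proof (rule lipschitz_onI)
    show "dist (f a) (f b) \<le> B * dist a b" for a b
      using le[of a b] le[of b a] by (simp add: dist_norm norm_minus_commute abs_le_iff)
  qed fact
  from lipschitz_on_continuous_on[OF this] show ?thesis unfolding f_def .
qed

lemma welfare_eq_inner:
  fixes a v :: "real ^ ('n::finite \<times> 'm::finite)"
  assumes part: "partition_on UNIV \<G>" and w: "\<And>G. G \<in> \<G> \<Longrightarrow> w G = real (card G)"
  shows "welfare \<G> w a v = a \<bullet> v"
proof -
  define f where "f j = (\<Sum>i\<in>UNIV. a $ (j, i) * v $ (j, i))" for j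
  \<comment> \<open>Blocks of a partition are nonempty, so the weight really cancels the division by
    the group size.\<close>
  have "card G \<noteq> 0" if "G \<in> \<G>" for G
    using partition_onD3[OF part] that by auto
  then have "welfare \<G> w a v = (\<Sum>G\<in>\<G>. \<Sum>j\<in>G. f j)"
    unfolding welfare_def group_utility_def f_def by (intro sum.cong) (auto simp: w)
  also have "\<dots> = (\<Sum>j\<in>\<Union>\<G>. f j)"
    using partition_onD2[OF part]
    by (subst sum.Union_disjoint) (auto simp: disjoint_def)
  also have "\<dots> = (\<Sum>j\<in>UNIV. f j)"
    using partition_onD1[OF part] by simp
  also have "\<dots> = a \<bullet> v"
    by (simp add: f_def inner_vec_def sum.cartesian_product)
  finally show ?thesis .
qed

lemma restr_le_partition:
  assumes "partition_on UNIV \<G>"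
  shows "(\<forall>G\<in>\<G>. restr_le G x y) \<longleftrightarrow> x \<le> y"
proof -
  have "\<exists>G\<in>\<G>. j \<in> G" for j using partition_onD1[OF assms] by (metis UNIV_I UnionE)
  then show ?thesis unfolding restr_le_def less_eq_vec_def by (metis surj_pair)
qed

section \<open>Equality of the two optimal values and recovery of an optimal allocation\<close>

theorem proposition3p1:
  fixes \<G> :: "'n::finite set set"
    and w :: "'n set \<Rightarrow> real"
    and kl ku :: "real ^ 'n"
    and pl pu :: "real ^ 'm::finite"
    and c :: "real ^ ('n \<times> 'm)"
    and vbar :: "'l::finite \<Rightarrow> real ^ ('n \<times> 'm)"
    and S :: "'l \<Rightarrow> real ^ ('n \<times> 'm) ^ ('n \<times> 'm)"
    and r :: "'l \<Rightarrow> real"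
    and Q :: "real ^ ('n \<times> 'm) ^ 'k::finite"
    and e :: "real ^ 'k"
    and A V :: "(real ^ ('n \<times> 'm)) set"
    and \<Phi> :: "real ^ ('n \<times> 'm) \<Rightarrow> real"
    and D :: "((real ^ ('n \<times> 'm)) \<times> (real ^ 'l) \<times> (real ^ 'k)) set"
    and \<Psi> :: "(real ^ ('n \<times> 'm)) \<times> (real ^ 'l) \<times> (real ^ 'k) \<Rightarrow> real"
  defines "A \<equiv> allocations kl ku pl pu c"
    and "V \<equiv> valuations vbar S r Q e"
    and "\<Phi> \<equiv> robust_welfare \<G> w V"
    and "D \<equiv> dual_feasible A Q"
    and "\<Psi> \<equiv> dual_objective vbar S r Q e"
  assumes groups: "partition_on UNIV \<G>"
    and weights: "\<And>G. G \<in> \<G> \<Longrightarrow> w G = real (card G)"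
    and vbar_nonneg: "\<And>i. 0 \<le> vbar i"
    and psd: "\<And>i. pos_semidef (S i)"
    and S_inv: "\<And>i. invertible (S i)"
    and slater: "\<exists>v. strictly_feasible vbar S r Q e v"
    and A_nonempty: "A \<noteq> {}"
  shows "(\<forall>a v :: real ^ ('n \<times> 'm). welfare \<G> w a v = a \<bullet> v)
    \<and> (\<forall>a\<in>A. \<exists>v. is_arg_min (welfare \<G> w a) (\<lambda>v. v \<in> V) v)
    \<and> (\<exists>a. is_arg_max \<Phi> (\<lambda>a. a \<in> A) a)
    \<and> (\<exists>d. is_arg_max \<Psi> (\<lambda>d. d \<in> D) d)
    \<and> (\<forall>a d. is_arg_max \<Phi> (\<lambda>a. a \<in> A) a \<longrightarrow> is_arg_max \<Psi> (\<lambda>d. d \<in> D) d \<longrightarrow> \<Phi> a = \<Psi> d)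
    \<and> (\<forall>\<xi> lam \<beta>. is_arg_max \<Psi> (\<lambda>d. d \<in> D) (\<xi>, lam, \<beta>) \<longrightarrow>
          (\<exists>a\<in>A. \<forall>G\<in>\<G>. restr_le G \<xi> a)
          \<and> (\<forall>a\<in>A. (\<forall>G\<in>\<G>. restr_le G \<xi> a) \<longrightarrow> is_arg_max \<Phi> (\<lambda>a. a \<in> A) a))"
proof -
  interpret ellipsoidal vbar S r Q e
    using psd S_inv by unfold_locales
  obtain v0 where v0: "strictly_feasible vbar S r Q e v0" using slater by blast
  then have "v0 \<in> V"
    by (auto simp: V_def valuations_def strictly_feasible_def less_eq_vec_def less_imp_le)
  then have V_nonempty: "V \<noteq> {}" by blast
  have V_compact: "compact V" unfolding V_def by (rule compact_valuations)
  have welfare: "welfare \<G> w a v = a \<bullet> v" for a v :: "real ^ ('n \<times> 'm)"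
    by (rule welfare_eq_inner[OF groups weights])
  have \<Phi>: "\<Phi> a = (INF v\<in>V. a \<bullet> v)" for a
    by (simp add: \<Phi>_def robust_welfare_def welfare)
  have attained: "\<exists>v\<in>V. \<forall>v'\<in>V. a \<bullet> v \<le> a \<bullet> v'" for a
    by (intro continuous_attains_inf V_compact V_nonempty continuous_intros)
  have \<Phi>_le: "\<Phi> a \<le> a \<bullet> v" if "v \<in> V" for a v
  proof -
    have "bdd_below ((\<lambda>v. a \<bullet> v) ` V)" using attained[of a] by (auto intro: bdd_belowI2)
    then show ?thesis unfolding \<Phi> by (rule cINF_lower[OF _ that])
  qed
  have le_\<Phi>: "b \<le> \<Phi> a" if "\<And>v. v \<in> V \<Longrightarrow> b \<le> a \<bullet> v" for a b
    unfolding \<Phi> using that by (intro cINF_greatest V_nonempty)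
  have weak: "\<Psi> (\<xi>, lam, \<beta>) \<le> \<Phi> a" if "(\<xi>, lam, \<beta>) \<in> D" "\<xi> \<le> a" for \<xi> lam \<beta> a
    using that weak_duality by (intro le_\<Phi>) (auto simp: D_def dual_feasible_def \<Psi>_def V_def)
  have above: "\<exists>a\<in>A. \<xi> \<le> a" if d: "(\<xi>, lam, \<beta>) \<in> D" for \<xi> lam \<beta>
  proof -
    obtain a y where "a \<in> A" "0 \<le> y" "\<xi> = a - y"
      using d unfolding D_def dual_feasible_def Lam_def by blast
    then show ?thesis by (intro bexI[of _ a]) (simp_all add: less_eq_vec_def)
  qed
  \<comment> \<open>The \<open>\<xi>\<close> from strong duality lies below \<open>a\<close>, so it
    belongs to \<open>Lam A\<close> and the multipliers form a dual feasible point.\<close>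
  have strong: "\<exists>d\<in>D. \<Phi> a \<le> \<Psi> d" if "a \<in> A" for a
  proof -
    obtain \<xi> lam \<beta> where d: "\<xi> \<le> a" "0 \<le> lam" "0 \<le> \<beta>" "lam = 0 \<longrightarrow> dual_p Q \<xi> \<beta> = 0"
      "\<Phi> a \<le> dual_objective vbar S r Q e (\<xi>, lam, \<beta>)"
      using strong_duality[OF v0] \<Phi>_le unfolding V_def by blast
    have "\<xi> = a - (a - \<xi>)" "0 \<le> a - \<xi>" using d(1) by (simp_all add: less_eq_vec_def)
    then have "\<xi> \<in> Lam A" using that unfolding Lam_def by blast
    with d have "(\<xi>, lam, \<beta>) \<in> D" by (simp add: D_def dual_feasible_def)
    with d(5) show ?thesis unfolding \<Psi>_def by blast
  qed
  have "compact A" unfolding A_def by (rule compact_allocations)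
  then have "\<exists>a\<in>A. \<forall>a'\<in>A. \<Phi> a' \<le> \<Phi> a"
    unfolding \<Phi> by (intro continuous_attains_sup A_nonempty continuous_on_INF_inner V_compact V_nonempty)
  then obtain a0 where a0: "a0 \<in> A" "\<And>a. a \<in> A \<Longrightarrow> \<Phi> a \<le> \<Phi> a0" by blast
  have \<Psi>_le: "\<Psi> d \<le> \<Phi> a0" if d: "d \<in> D" for d
  proof (cases d)
    case (fields \<xi> lam \<beta>)
    with d above obtain a where "a \<in> A" "\<xi> \<le> a" by blast
    with weak[of \<xi> lam \<beta> a] a0(2)[of a] d fields show ?thesis by simp
  qed
  obtain d0 where d0: "d0 \<in> D" "\<Phi> a0 \<le> \<Psi> d0" using strong[OF a0(1)] by blast
  \<comment> \<open>Both problems have the optimal value \<open>\<Phi> a0\<close>, so optimality on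
    either side becomes feasibility together with attaining this number.\<close>
  have max_\<Phi>: "is_arg_max \<Phi> (\<lambda>a. a \<in> A) a \<longleftrightarrow> a \<in> A \<and> \<Phi> a = \<Phi> a0" for a
    using a0 unfolding is_arg_max_def by (metis leD order_antisym not_le)
  have max_\<Psi>: "is_arg_max \<Psi> (\<lambda>d. d \<in> D) d \<longleftrightarrow> d \<in> D \<and> \<Psi> d = \<Phi> a0" for d
    using d0 \<Psi>_le unfolding is_arg_max_def by (metis leD order_antisym not_le)
  have "\<exists>v. is_arg_min (welfare \<G> w a) (\<lambda>v. v \<in> V) v" for a
    using attained[of a] unfolding is_arg_min_def welfare by (meson leD)
  \<comment> \<open>An allocation above an optimal \<open>\<xi>\<close> is squeezed: weak duality
    gives \<open>\<Phi> a0 \<le> \<Phi> a\<close>, and maximality of \<open>a0\<close> gives the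
    converse.\<close>
  moreover have "is_arg_max \<Phi> (\<lambda>a. a \<in> A) a" if "\<Psi> (\<xi>, lam, \<beta>) = \<Phi> a0" "(\<xi>, lam, \<beta>) \<in> D"
    "a \<in> A" "\<xi> \<le> a" for \<xi> lam \<beta> a
    unfolding max_\<Phi> using weak[OF that(2,4)] a0(2)[OF that(3)] that by simp
  moreover have "is_arg_max \<Psi> (\<lambda>d. d \<in> D) d0"
    unfolding max_\<Psi> using d0 \<Psi>_le by (simp add: order_antisym)
  moreover have "is_arg_max \<Phi> (\<lambda>a. a \<in> A) a0"
    unfolding max_\<Phi> using a0(1) by simp
  ultimately show ?thesis
    unfolding restr_le_partition[OF groups]
    using welfare above by (auto simp: max_\<Phi> max_\<Psi> simp del: split_paired_Ex)
qed

end
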